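(* Let $(E,A)$ satisfy the standing assumptions below and set $p:=p_{\mathrm{res}}^{(E,A)}+1$. Then there exists a family of operators $(S_r(t))_{t\geq 0}$ on $X_{\operatorname{ran}} \coloneqq \overline{\operatorname{ran} R_r(\lambda)^{p}}$ and $\omega\in \mathbb R$, $C>0$ with $\Vert S_r(t)\Vert \leq C\mathrm{e}^{\omega t}$ and \[ R_r(\lambda)x_0 = \lambda^p \int_0^\infty \mathrm{e}^{-\lambda t} S_r(t)x_0 \,\mathrm{d}t \quad \text{for all } \lambda \in \rho(E,A)\cap \mathbb C_{\operatorname{Re} >\omega} \text{ and } x_0\in X_{\operatorname{ran}}. \]
   Context: Standing assumptions: $X$ and $Z$ are complex Banach spaces; $E\in L(X,Z)$ is bounded; $A\colon\mathrm{dom}(A)\subseteq X\to Z$ is closed and densely defined; $\rho(E,A)=\{\lambda\in\mathbb C : (\lambda E-A)^{-1}\in L(Z,X)\}$; the pair $(E,A)$ has a complex resolvent index, i.e.~there is a smallest $p_{\mathrm{res}}^{(E,A)}\in\mathbb N_0$ such that for some $\omega\in\mathbb R$, $C>0$ one has $\mathbb C_{\operatorname{Re}>\omega}\subseteq\rho(E,A)$ and $\Vert(\lambda E-A)^{-1}\Vert\le C|\lambda|^{p_{\mathrm{res}}^{(E,A)}-1}$ for all $\lambda\in\mathbb C_{\operatorname{Re}>\omega}$. Here $R_r(\lambda)\coloneqq(\lambda E-A)^{-1}E$ (right resolvent), $\operatorname{ran}$ denotes the range of an operator, and $\mathbb C_{\operatorname{Re}>\omega}=\{\lambda\in\mathbb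 C:\operatorname{Re}\lambda>\omega\}$. *)

theory Defs
  imports "HOL-Analysis.Analysis"
begin

class complex_normed_vector = real_normed_vector +
  fixes scaleC :: "complex \<Rightarrow> 'a \<Rightarrow> 'a"
  assumes scaleC_of_real: "scaleC (of_real r) x = scaleR r x"
    and scaleC_add_right: "scaleC a (x + y) = scaleC a x + scaleC a y"
    and scaleC_add_left: "scaleC (a + b) x = scaleC a x + scaleC b x"
    and scaleC_scaleC: "scaleC a (scaleC b x) = scaleC (a * b) x"
    and scaleC_one: "scaleC 1 x = x"
    and norm_scaleC: "norm (scaleC a x) = cmod a * norm x"

class complex_banach = complex_normed_vector + banach

instantiation complex :: complex_normed_vector
begin
definition scaleC_complex :: "complex \<Rightarrow> complex \<Rightarrow> complex" where
  "scaleC_complex a x = a * x"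
instance
  by standard (auto simp: scaleC_complex_def scaleR_conv_of_real algebra_simps norm_mult)
end

instance complex :: complex_banach ..

definition bounded_clinear_op :: "('a::complex_normed_vector \<Rightarrow> 'b::complex_normed_vector) \<Rightarrow> bool" where
  "bounded_clinear_op T \<longleftrightarrow> bounded_linear T \<and> (\<forall>c x. T (scaleC c x) = scaleC c (T x))"

definition closed_densely_defined ::
  "'a::complex_normed_vector set \<Rightarrow> ('a \<Rightarrow> 'b::complex_normed_vector) \<Rightarrow> bool" where
  "closed_densely_defined D A \<longleftrightarrow>
     0 \<in> D \<and> (\<forall>x\<in>D. \<forall>y\<in>D. x + y \<in> D \<and> A (x + y) = A x + A y) \<and>
     (\<forall>c. \<forall>x\<in>D. scaleC c x \<in> D \<and> A (scaleC c x) = scaleC c (A x)) \<and>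
     closed ((\<lambda>x. (x, A x)) ` D) \<and> closure D = UNIV"

definition pencil :: "('a \<Rightarrow> 'b::complex_normed_vector) \<Rightarrow> ('a \<Rightarrow> 'b) \<Rightarrow> complex \<Rightarrow> 'a \<Rightarrow> 'b::complex_normed_vector" where
  "pencil E A l x = scaleC l (E x) - A x"

definition pencil_res :: "('a::complex_normed_vector \<Rightarrow> 'b::complex_normed_vector) \<Rightarrow> 'a set \<Rightarrow> ('a \<Rightarrow> 'b) \<Rightarrow> complex \<Rightarrow> 'b \<Rightarrow> 'a::complex_normed_vector"
  where "pencil_res E D A l = inv_into D (pencil E A l)"

definition pencil_resolvent_set ::
  "('a::complex_normed_vector \<Rightarrow> 'b::complex_normed_vector) \<Rightarrow> 'a set \<Rightarrow> ('a \<Rightarrow> 'b) \<Rightarrow> complex set" where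
  "pencil_resolvent_set E D A =
     {l. bij_betw (pencil E A l) D UNIV \<and> bounded_clinear_op (pencil_res E D A l)}"

definition resolvent_growth ::
  "('a::complex_normed_vector \<Rightarrow> 'b::complex_normed_vector) \<Rightarrow> 'a set \<Rightarrow> ('a \<Rightarrow> 'b) \<Rightarrow> nat \<Rightarrow> bool" where
  "resolvent_growth E D A p \<longleftrightarrow>
     (\<exists>\<omega>::real. \<exists>C::real. C > 0 \<and> {l. Re l > \<omega>} \<subseteq> pencil_resolvent_set E D A \<and>
        (\<forall>l. Re l > \<omega> \<longrightarrow> onorm (pencil_res E D A l) \<le> C * cmod l powi (int p - 1)))"

definition has_complex_resolvent_index ::
  "('a::complex_normed_vector \<Rightarrow> 'b::complex_normed_vector) \<Rightarrow> 'a set \<Rightarrow> ('a \<Rightarrow> 'b) \<Rightarrow> bool" where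
  "has_complex_resolvent_index E D A \<longleftrightarrow> (\<exists>p. resolvent_growth E D A p)"

definition p_res ::
  "('a::complex_normed_vector \<Rightarrow> 'b::complex_normed_vector) \<Rightarrow> 'a set \<Rightarrow> ('a \<Rightarrow> 'b) \<Rightarrow> nat" where
  "p_res E D A = (LEAST p. resolvent_growth E D A p)"

definition right_resolvent ::
  "('a::complex_normed_vector \<Rightarrow> 'b::complex_normed_vector) \<Rightarrow> 'a set \<Rightarrow> ('a \<Rightarrow> 'b) \<Rightarrow> complex \<Rightarrow> 'a \<Rightarrow> 'a" where
  "right_resolvent E D A l = pencil_res E D A l \<circ> E"

definition X_ran ::
  "('a::complex_normed_vector \<Rightarrow> 'b::complex_normed_vector) \<Rightarrow> 'a set \<Rightarrow> ('a \<Rightarrow> 'b) \<Rightarrow> complex \<Rightarrow> nat \<Rightarrow> 'a set" where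
  "X_ran E D A l p = closure (range (right_resolvent E D A l ^^ p))"

end

theory Submission
  imports Defs
begin

text \<open>
  Write \<open>F(\<mu>) = \<mu>\<^sup>-\<^sup>p R\<^sub>r(\<mu>)\<close>. As \<open>R\<^sub>r(\<mu>)\<close> grows at most like \<open>\<bar>\<mu>\<bar>\<close> to the power \<open>p - 2\<close>, \<open>F\<close> is of order
  \<open>\<bar>\<mu>\<bar>\<close> to the power \<open>-2\<close>, so the inversion integral
  \<open>S(t) x = (1 / 2 \<pi>) \<integral> exp (t \<mu>) F(\<mu>) x ds\<close> over the line \<open>\<mu> = c + i s\<close> converges absolutely, with norm
  of order \<open>exp (c t)\<close>. Since \<open>R\<^sub>r(\<mu>)\<close> commutes with \<open>R\<^sub>r(\<lambda>\<^sub>0)\<close>, \<open>S(t)\<close> leaves the closed space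
  \<open>X\<^sub>r\<^sub>a\<^sub>n\<close> invariant. Exchanging integrals, the Laplace transform of \<open>S(t) x\<close> at \<open>\<lambda>\<close> is
  \<open>(1 / 2 \<pi>) \<integral> F(\<mu>) x / (\<lambda> - \<mu>) ds\<close>. By the resolvent identity the integrand equals
  \<open>R\<^sub>r(\<lambda>) x / (\<mu>\<^sup>p (\<lambda> - \<mu>)) + R\<^sub>r(\<lambda>) F(\<mu>) x\<close>: the first summand contributes a scalar integral,
  giving \<open>\<lambda>\<^sup>-\<^sup>p R\<^sub>r(\<lambda>) x\<close>, and the second integrates to zero by moving the line to the right.
  Neither Bochner integrals nor Hahn-Banach are available for an arbitrary Banach space, so all
  integrals are limits of gauge integrals over compact intervals, and Cauchy's theorem is used for
  rectangles only, where it follows from the fundamental theorem of calculus and an exchange of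
  integrals.
\<close>

section \<open>Banach space valued integrals\<close>

text \<open>Through the interpretation that follows, complex scaling inherits the general product
  rules for limits, continuity and derivatives.\<close>

lemma bounded_bilinear_scaleC:
  "bounded_bilinear (scaleC :: complex \<Rightarrow> 'a::complex_normed_vector \<Rightarrow> 'a)"
proof
  fix a b :: complex and r :: real and x y :: 'a
  show "scaleC (a + b) x = scaleC a x + scaleC b x" by (rule scaleC_add_left)
  show "scaleC a (x + y) = scaleC a x + scaleC a y" by (rule scaleC_add_right)
  show "scaleC (r *\<^sub>R a) x = r *\<^sub>R scaleC a x"
    by (simp add: scaleR_conv_of_real flip: scaleC_scaleC scaleC_of_real)
  show "scaleC a (r *\<^sub>R x) = r *\<^sub>R scaleC a x"
    by (simp add: scaleC_scaleC mult.commute flip: scaleC_of_real)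
  show "\<exists>K. \<forall>a x. norm (scaleC a (x::'a)) \<le> norm a * norm x * K"
    by (rule exI[of _ 1]) (simp add: norm_scaleC)
qed

interpretation scaleC: bounded_bilinear "scaleC :: complex \<Rightarrow> 'a::complex_normed_vector \<Rightarrow> 'a"
  by (rule bounded_bilinear_scaleC)

text \<open>The cut-offs are symmetric because some scalar integrals below converge only as
  principal values, and integral so that an improper integral is the limit of a sequence.\<close>

definition symint :: "(real \<Rightarrow> 'a::banach) \<Rightarrow> nat \<Rightarrow> 'a" where
  "symint h n = integral {- real n..real n} h"

section \<open>Integrals over the real line under a quadratic decay bound\<close>

lemma integral_inverse_quadratic:
  fixes c :: real
  assumes "0 < c" "a \<le> b"
  shows "((\<lambda>s. K / (c\<^sup>2 + s\<^sup>2)) has_integral K / c * (arctan (b / c) - arctan (a / c))) {a..b}"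
proof -
  have "((\<lambda>s. K / c * arctan (s / c)) has_vector_derivative K / (c\<^sup>2 + s\<^sup>2)) (at s within {a..b})" for s
  proof -
    have "1 + (s / c)\<^sup>2 = (c\<^sup>2 + s\<^sup>2) / c\<^sup>2"
      using assms(1) by (simp add: field_simps)
    with assms(1) have eq: "K / c * (1 / c / (1 + (s / c)\<^sup>2)) = K / (c\<^sup>2 + s\<^sup>2)"
      by (simp add: power2_eq_square)
    have "((\<lambda>s. K / c * arctan (s / c)) has_real_derivative
        K / c * (1 / c / (1 + (s / c)\<^sup>2))) (at s within {a..b})"
      by (auto intro!: derivative_eq_intros simp: divide_inverse mult_ac)
    then show ?thesis
      unfolding eq by (simp only: has_real_derivative_iff_has_vector_derivative)
  qed
  from fundamental_theorem_of_calculus[OF assms(2) this] show ?thesis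
    by (simp add: right_diff_distrib)
qed

text \<open>On the line through \<open>c\<close> the majorant is \<open>K\<close> divided by the
  squared modulus of \<open>Complex c s\<close>; its antiderivative
  \<open>K / c * arctan (s / c)\<close> makes every later tail estimate explicit.\<close>

lemma norm_integral_le_arctan:
  fixes h :: "real \<Rightarrow> 'a::banach"
  assumes "0 < c" "a \<le> b" "continuous_on UNIV h" "\<And>s. norm (h s) \<le> K / (c\<^sup>2 + s\<^sup>2)"
  shows "norm (integral {a..b} h) \<le> K / c * (arctan (b / c) - arctan (a / c))"
proof -
  note int = integral_inverse_quadratic[OF assms(1,2), of K]
  have "norm (integral {a..b} h) \<le> integral {a..b} (\<lambda>s. K / (c\<^sup>2 + s\<^sup>2))"
    by (intro integral_norm_bound_integral[OF _ has_integral_integrable[OF int]] assms(4)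
        integrable_continuous_interval continuous_on_subset[OF assms(3)]) auto
  then show ?thesis
    using int by (simp add: integral_unique)
qed

text \<open>Two outer intervals remain after cancellation, and they contribute equally because
  \<open>arctan\<close> is odd.\<close>

lemma symint_diff_le:
  fixes h :: "real \<Rightarrow> 'a::banach"
  assumes "0 < c" "continuous_on UNIV h" "\<And>s. norm (h s) \<le> K / (c\<^sup>2 + s\<^sup>2)" "m \<le> n"
  shows "norm (symint h n - symint h m) \<le> 2 * K / c * (arctan (n / c) - arctan (m / c))"
proof -
  have i: "h integrable_on {a..b}" for a b
    by (rule integrable_continuous_interval[OF continuous_on_subset[OF assms(2)]]) simp
  have "symint h n = integral {- real n..- real m} h + integral {- real m..real n} h"
    unfolding symint_def using assms(4) by (intro Henstock_Kurzweil_Integration.integral_combine[symmetric] i) auto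
  moreover have "integral {- real m..real n} h = symint h m + integral {real m..real n} h"
    unfolding symint_def using assms(4) by (intro Henstock_Kurzweil_Integration.integral_combine[symmetric] i) auto
  ultimately have "symint h n - symint h m
      = integral {- real n..- real m} h + integral {real m..real n} h"
    by simp
  also have "norm \<dots> \<le> K / c * (arctan (- real m / c) - arctan (- real n / c))
      + K / c * (arctan (n / c) - arctan (m / c))"
    using assms by (intro norm_triangle_mono norm_integral_le_arctan) auto
  also have "\<dots> = 2 * K / c * (arctan (n / c) - arctan (m / c))"
    by (simp add: arctan_minus algebra_simps)
  finally show ?thesis .
qed

lemma arctan_scaled_tendsto:
  assumes "0 < c"
  shows "(\<lambda>n. arctan (real n / c)) \<longlonglongrightarrow> pi / 2"
proof -
  have "filterlim (\<lambda>n. real n * (1 / c)) at_top sequentially"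
    using assms
    by (intro filterlim_at_top_mult_tendsto_pos[OF tendsto_const] filterlim_real_sequentially) auto
  then have "filterlim (\<lambda>n. real n / c) at_top sequentially"
    by simp
  then show ?thesis
    by (rule filterlim_compose[OF tendsto_arctan_at_top])
qed

text \<open>The truncations inherit the Cauchy property from a convergent scalar sequence. The tail
  bound sees \<open>h\<close> only through \<open>K\<close>, which later gives uniformity in a
  parameter.\<close>

lemma symint_tail_le:
  fixes h :: "real \<Rightarrow> 'a::banach"
  assumes "0 < c" "continuous_on UNIV h" "\<And>s. norm (h s) \<le> K / (c\<^sup>2 + s\<^sup>2)"
  shows symint_convergent: "symint h \<longlonglongrightarrow> lim (symint h)"
    and "norm (lim (symint h) - symint h m) \<le> 2 * K / c * (pi / 2 - arctan (m / c))"
proof -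
  have K: "0 \<le> K"
    using order_trans[OF norm_ge_zero assms(3)[of 0]] assms(1) by (simp add: zero_le_divide_iff)
  let ?g = "\<lambda>n. 2 * K / c * arctan (real n / c)"
  have g: "?g \<longlonglongrightarrow> 2 * K / c * (pi / 2)"
    by (intro tendsto_intros arctan_scaled_tendsto assms)
  \<comment> \<open>The norm on the right makes the estimate symmetric in \<open>m\<close> and
    \<open>n\<close>, as the Cauchy criterion wants it.\<close>
  have le: "norm (symint h n - symint h m) \<le> norm (?g n - ?g m)" for m n
  proof (cases m n rule: le_cases)
    case le
    with symint_diff_le[OF assms le] show ?thesis
      by (smt (verit) real_norm_def right_diff_distrib)
  next
    case ge
    with symint_diff_le[OF assms ge] show ?thesis
      by (smt (verit) real_norm_def right_diff_distrib norm_minus_commute)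
  qed
  have "Cauchy (symint h)"
  proof (rule metric_CauchyI)
    fix e :: real assume "0 < e"
    with LIMSEQ_imp_Cauchy[OF g] obtain M where "\<forall>m\<ge>M. \<forall>n\<ge>M. dist (?g m) (?g n) < e"
      unfolding Cauchy_def by blast
    then show "\<exists>M. \<forall>m\<ge>M. \<forall>n\<ge>M. dist (symint h m) (symint h n) < e"
      using le unfolding dist_norm by (meson order_le_less_trans)
  qed
  then show lim: "symint h \<longlonglongrightarrow> lim (symint h)"
    by (simp add: Cauchy_convergent_iff convergent_LIMSEQ_iff)
  show "norm (lim (symint h) - symint h m) \<le> 2 * K / c * (pi / 2 - arctan (m / c))"
  proof (rule tendsto_le[OF trivial_limit_sequentially])
    show "(\<lambda>n. norm (symint h n - symint h m)) \<longlonglongrightarrow> norm (lim (symint h) - symint h m)"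
      by (intro tendsto_intros lim)
    show "(\<lambda>n. 2 * K / c * (arctan (real n / c) - arctan (m / c)))
        \<longlonglongrightarrow> 2 * K / c * (pi / 2 - arctan (m / c))"
      by (intro tendsto_intros arctan_scaled_tendsto assms)
    show "\<forall>\<^sub>F n in sequentially. norm (symint h n - symint h m)
        \<le> 2 * K / c * (arctan (real n / c) - arctan (m / c))"
      using symint_diff_le[OF assms] by (auto intro: eventually_sequentiallyI[of m])
  qed
qed

lemma norm_symint_le:
  fixes h :: "real \<Rightarrow> 'a::banach"
  assumes "0 < c" "continuous_on UNIV h" "\<And>s. norm (h s) \<le> K / (c\<^sup>2 + s\<^sup>2)"
  shows "norm (symint h n) \<le> K * pi / c"
proof -
  have K: "0 \<le> K"
    using order_trans[OF norm_ge_zero assms(3)[of 0]] assms(1) by (simp add: zero_le_divide_iff)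
  have "norm (symint h n) \<le> K / c * (arctan (n / c) - arctan (- real n / c))"
    unfolding symint_def using assms by (intro norm_integral_le_arctan) auto
  also have "\<dots> \<le> K / c * (pi / 2 - (- (pi / 2)))"
    using K assms(1) by (intro mult_left_mono diff_mono less_imp_le[OF arctan_ubound]
        less_imp_le[OF arctan_lbound]) auto
  finally show ?thesis by simp
qed

text \<open>Every Riemann sum lies in \<open>V\<close> because its tags lie in
  \<open>{a..b}\<close>, and the integral is a limit of such sums.\<close>

lemma integral_in_closed_subspace:
  fixes f :: "real \<Rightarrow> 'a::banach"
  assumes "closed V" "subspace V" "f integrable_on {a..b}" "\<And>x. x \<in> {a..b} \<Longrightarrow> f x \<in> V"
  shows "integral {a..b} f \<in> V"
proof -
  have "\<exists>y\<in>V. dist y (integral {a..b} f) < e" if "0 < e" for e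
  proof -
    have "(f has_integral integral {a..b} f) (cbox a b)"
      using assms(3) by (simp add: integrable_integral)
    then obtain \<gamma> where \<gamma>: "gauge \<gamma>" "\<And>p. p tagged_division_of cbox a b \<Longrightarrow> \<gamma> fine p \<Longrightarrow>
        norm ((\<Sum>(x,k)\<in>p. measure lborel k *\<^sub>R f x) - integral {a..b} f) < e"
      using \<open>0 < e\<close> unfolding has_integral by metis
    obtain p where p: "p tagged_division_of cbox a b" "\<gamma> fine p"
      using fine_division_exists[OF \<gamma>(1)] .
    have "(\<Sum>(x,k)\<in>p. measure lborel k *\<^sub>R f x) \<in> V"
    proof (rule subspace_sum[OF assms(2)], clarify)
      fix x k assume "(x, k) \<in> p"
      then have "x \<in> {a..b}"
        using tagged_division_ofD(2,3)[OF p(1)] unfolding box_real by blast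
      then show "measure lborel k *\<^sub>R f x \<in> V"
        by (intro subspace_scale assms)
    qed
    with \<gamma>(2)[OF p] show ?thesis
      unfolding dist_norm by blast
  qed
  then show ?thesis
    using assms(1) by (metis closure_approachable closure_closed)
qed

text \<open>For the function extended by zero, a box reaching to the left of 0 sees only
  \<open>{0..b}\<close>, so the gauge integral over the half-line is the limit of the integrals over
  \<open>{0..t}\<close>.\<close>

lemma has_integral_half_lineI:
  fixes f :: "real \<Rightarrow> 'a::banach"
  assumes "\<And>t. 0 \<le> t \<Longrightarrow> f integrable_on {0..t}"
    and "((\<lambda>t. integral {0..t} f) \<longlongrightarrow> I) at_top"
  shows "(f has_integral I) {0..}"
proof -
  let ?f = "\<lambda>x. if x \<in> {0..} then f x else 0"
  have eq: "(?f has_integral J) {a..b} \<longleftrightarrow> (f has_integral J) {0..b}"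
    if "a \<le> 0" for a b J
  proof -
    have "{0..} \<inter> {a..b} = {0..b}" using that by auto
    then show ?thesis
      by (metis has_integral_restrict_Int)
  qed
  have int: "(?f has_integral integral {0..b} f) {a..b}" if "a \<le> 0" "0 \<le> b" for a b
    using eq[OF that(1)] assms(1)[OF that(2)] by (simp add: integrable_integral)
  show ?thesis
    unfolding has_integral_alt'[of f]
  proof (intro conjI allI impI)
    fix a b :: real
    have "?f integrable_on {min a 0..max b 0}"
      using int[of "min a 0" "max b 0"] by (auto simp: integrable_on_def)
    then show "?f integrable_on cbox a b"
      unfolding box_real by (rule integrable_subinterval_real) auto
  next
    fix e :: real assume "0 < e"
    with assms(2) obtain N where N: "\<And>t. N \<le> t \<Longrightarrow> norm (integral {0..t} f - I) < e"
      unfolding tendsto_iff dist_norm eventually_at_top_linorder by blast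
    show "\<exists>B>0. \<forall>a b. ball 0 B \<subseteq> cbox a b \<longrightarrow> norm (integral (cbox a b) ?f - I) < e"
    \<comment> \<open>The extra 1 puts both 0 and \<open>\<bar>N\<bar>\<close> into the open ball,
      hence into the box.\<close>
    proof (intro exI[of _ "\<bar>N\<bar> + 1"] conjI allI impI)
      fix a b :: real assume sub: "ball 0 (\<bar>N\<bar> + 1) \<subseteq> cbox a b"
      have "\<bar>N\<bar> \<in> ball 0 (\<bar>N\<bar> + 1)" "0 \<in> ball 0 (\<bar>N\<bar> + 1)" by auto
      with sub have "0 \<in> cbox a b" "\<bar>N\<bar> \<in> cbox a b" by blast+
      then have "a \<le> 0" "\<bar>N\<bar> \<le> b" by auto
      then have "integral (cbox a b) ?f = integral {0..b} f" "N \<le> b"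
        using integral_unique[OF int[of a b]] by auto
      with N show "norm (integral (cbox a b) ?f - I) < e"
        by simp
    qed auto
  qed
qed

text \<open>Cauchy's theorem for a rectangle; the factor \<open>\<i>\<close> is the tangent of the
  vertical sides. Both sides equal the double integral of \<open>scaleC \<i> (f' z)\<close>, by the
  fundamental theorem along horizontal or vertical segments and an exchange of integrals.\<close>

lemma integral_rectangle:
  fixes f f' :: "complex \<Rightarrow> 'a::{complex_normed_vector,banach}"
  assumes "a \<le> b" "c \<le> d"
    and der: "\<And>z. Re z \<in> {a..b} \<Longrightarrow> Im z \<in> {c..d} \<Longrightarrow>
      (f has_derivative (\<lambda>h. scaleC h (f' z))) (at z)"
    and cont: "continuous_on {z. Re z \<in> {a..b} \<and> Im z \<in> {c..d}} f'"
  shows "scaleC \<i> (integral {c..d} (\<lambda>s. f (Complex b s)) - integral {c..d} (\<lambda>s. f (Complex a s)))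
    = integral {a..b} (\<lambda>u. f (Complex u d)) - integral {a..b} (\<lambda>u. f (Complex u c))"
proof -
  have cf: "continuous_on {z. Re z \<in> {a..b} \<and> Im z \<in> {c..d}} f"
    by (rule has_derivative_continuous_on, rule has_derivative_at_withinI, rule der) auto
  have I1: "((\<lambda>u. f' (Complex u s)) has_integral (f (Complex b s) - f (Complex a s))) {a..b}"
    if "s \<in> {c..d}" for s
  proof (rule fundamental_theorem_of_calculus[OF assms(1)])
    fix u assume u: "u \<in> {a..b}"
    have "((\<lambda>u. Complex u s) has_derivative of_real) (at u within {a..b})"
      unfolding Complex_eq by (rule derivative_eq_intros refl)+ simp
    from diff_chain_within[OF this has_derivative_at_withinI[OF der]] that u
    show "((\<lambda>u. f (Complex u s)) has_vector_derivative f' (Complex u s)) (at u within {a..b})"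
      by (simp add: has_vector_derivative_def o_def scaleC_of_real)
  qed
  have I2: "((\<lambda>s. scaleC \<i> (f' (Complex u s))) has_integral (f (Complex u d) - f (Complex u c))) {c..d}"
    if "u \<in> {a..b}" for u
  proof (rule fundamental_theorem_of_calculus[OF assms(2)])
    fix s assume s: "s \<in> {c..d}"
    have "((\<lambda>s. Complex u s) has_derivative (\<lambda>h. of_real h * \<i>)) (at s within {c..d})"
      unfolding Complex_eq by (rule derivative_eq_intros refl)+ (simp add: mult.commute)
    from diff_chain_within[OF this has_derivative_at_withinI[OF der]] that s
    have "((\<lambda>s. f (Complex u s)) has_derivative (\<lambda>h. scaleC (of_real h * \<i>) (f' (Complex u s))))
        (at s within {c..d})"
      by (simp add: o_def)
    then show "((\<lambda>s. f (Complex u s)) has_vector_derivative scaleC \<i> (f' (Complex u s))) (at s within {c..d})"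
      by (simp only: has_vector_derivative_def scaleC_scaleC[symmetric] scaleC_of_real)
  qed
  \<comment> \<open>The parameter space is left general so that the rule serves single segments as
    well as the two-variable integrand.\<close>
  have cmp: "continuous_on S (\<lambda>x. g (Complex (p x) (q x)))"
    if "continuous_on {z. Re z \<in> {a..b} \<and> Im z \<in> {c..d}} g" "continuous_on S p" "continuous_on S q"
      "\<And>x. x \<in> S \<Longrightarrow> p x \<in> {a..b}" "\<And>x. x \<in> S \<Longrightarrow> q x \<in> {c..d}"
    for S :: "'s::topological_space set" and p q and g :: "complex \<Rightarrow> 'a"
    using that by (intro continuous_on_compose2[OF that(1)])
      (auto intro!: continuous_intros simp: Complex_eq)
  have i1: "(\<lambda>s. f (Complex u s)) integrable_on {c..d}" if "u \<in> {a..b}" for u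
    using that by (intro integrable_continuous_interval cmp cf) auto
  have i2: "(\<lambda>u. f (Complex u s)) integrable_on {a..b}" if "s \<in> {c..d}" for s
    using that by (intro integrable_continuous_interval cmp cf) auto
  have "integral {c..d} (\<lambda>s. f (Complex b s)) - integral {c..d} (\<lambda>s. f (Complex a s))
      = integral {c..d} (\<lambda>s. f (Complex b s) - f (Complex a s))"
    using assms by (intro integral_diff[symmetric] i1) auto
  also have "\<dots> = integral {c..d} (\<lambda>s. integral {a..b} (\<lambda>u. f' (Complex u s)))"
    by (intro integral_cong) (simp add: integral_unique[OF I1])
  also have "scaleC \<i> \<dots> = integral {c..d} (\<lambda>s. scaleC \<i> (integral {a..b} (\<lambda>u. f' (Complex u s))))"
  proof -
    have "(\<lambda>s. integral {a..b} (\<lambda>u. f' (Complex u s))) integrable_on {c..d}"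
      using assms(1) by (subst integrable_cong[OF integral_unique[OF I1]])
        (auto intro!: integrable_diff i1)
    from integral_linear[OF this scaleC.bounded_linear_right] show ?thesis
      by (simp add: o_def)
  qed
  also have "\<dots> = integral {c..d} (\<lambda>s. integral {a..b} (\<lambda>u. scaleC \<i> (f' (Complex u s))))"
  proof (intro integral_cong)
    fix s assume "s \<in> {c..d}"
    from integral_linear[OF has_integral_integrable[OF I1[OF this]] scaleC.bounded_linear_right, of \<i>]
    show "scaleC \<i> (integral {a..b} (\<lambda>u. f' (Complex u s)))
        = integral {a..b} (\<lambda>u. scaleC \<i> (f' (Complex u s)))"
      by (simp add: o_def)
  qed
  also have "\<dots> = integral {a..b} (\<lambda>u. integral {c..d} (\<lambda>s. scaleC \<i> (f' (Complex u s))))"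
    unfolding box_real[symmetric]
    by (rule integral_swap_continuous)
      (auto simp: case_prod_unfold cbox_Pair_eq intro!: continuous_intros scaleC.continuous_on cmp cont)
  also have "\<dots> = integral {a..b} (\<lambda>u. f (Complex u d) - f (Complex u c))"
    by (intro integral_cong) (simp add: integral_unique[OF I2])
  also have "\<dots> = integral {a..b} (\<lambda>u. f (Complex u d)) - integral {a..b} (\<lambda>u. f (Complex u c))"
    using assms by (intro integral_diff i2) auto
  finally show ?thesis .
qed

section \<open>Scalar integrals along a vertical line\<close>

lemma of_nat_scaled_tendsto_0: "(\<lambda>n. w / of_nat n) \<longlonglongrightarrow> (0 :: complex)"
  by (rule tendsto_divide_0[OF tendsto_const tendsto_of_nat])

lemma Re_pos_not_nonpos_Reals: "0 < Re z \<Longrightarrow> z \<notin> \<real>\<^sub>\<le>\<^sub>0"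
  by (auto simp: complex_nonpos_Reals_iff)

text \<open>The integral exists only as a principal value.\<close>

lemma symint_inverse_tendsto:
  assumes "0 < Re w"
  shows "symint (\<lambda>s. inverse (w + \<i> * of_real s)) \<longlonglongrightarrow> of_real pi"
proof -
  let ?a = "\<lambda>n. Ln (w / of_nat n + \<i>)" and ?b = "\<lambda>n. Ln (w / of_nat n - \<i>)"
  \<comment> \<open>Factoring out \<open>n\<close> keeps the argument of \<open>Ln\<close> bounded and away from the branch cut.\<close>
  have scale: "Ln (w + of_real (real n) * v) = of_real (ln (real n)) + Ln (w / of_nat n + v)"
    if "0 < n" "Re v = 0" for n v
  proof -
    have "w / of_nat n + v \<noteq> 0"
      using assms that by (auto simp: complex_eq_iff)
    then have "Ln (of_real (real n) * (w / of_nat n + v)) = of_real (ln (real n)) + Ln (w / of_nat n + v)"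
      using that by (subst Ln_times_of_real) (auto simp: Ln_of_real)
    moreover have "of_real (real n) * (w / of_nat n + v) = w + of_real (real n) * v"
      using that by (simp add: field_simps)
    ultimately show ?thesis
      by simp
  qed
  have eq: "symint (\<lambda>s. inverse (w + \<i> * of_real s)) n = - \<i> * (?a n - ?b n)" if "0 < n" for n
  proof -
    have "((\<lambda>s. - \<i> * Ln (w + \<i> * of_real s)) has_vector_derivative inverse (w + \<i> * of_real s))
        (at s within {- real n..real n})" for s
    proof -
      have "((\<lambda>z. - \<i> * Ln (w + \<i> * z)) has_field_derivative inverse (w + \<i> * of_real s)) (at (of_real s))"
        using assms by (auto intro!: derivative_eq_intros Re_pos_not_nonpos_Reals simp: mult.assoc)
      from has_vector_derivative_at_within[OF has_vector_derivative_real_field[OF this]]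
      show ?thesis .
    qed
    then have "((\<lambda>s. inverse (w + \<i> * of_real s)) has_integral
        (- \<i> * Ln (w + \<i> * of_real (real n)) - (- \<i> * Ln (w + \<i> * of_real (- real n))))) {- real n..real n}"
      by (intro fundamental_theorem_of_calculus) auto
    then have "symint (\<lambda>s. inverse (w + \<i> * of_real s)) n
        = - \<i> * (Ln (w + of_real (real n) * \<i>) - Ln (w + of_real (real n) * (- \<i>)))"
      unfolding symint_def by (simp add: integral_unique algebra_simps)
    \<comment> \<open>The divergent terms \<open>ln (real n)\<close> from the two ends cancel; this
      is where symmetry of the interval counts.\<close>
    also have "\<dots> = - \<i> * (?a n - ?b n)"
      using scale[OF that, of \<i>] scale[OF that, of "- \<i>"] by simp
    finally show ?thesis .
  qed
  \<comment> \<open>As \<open>w / of_nat n\<close> vanishes, the limit no longer depends on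
    \<open>w\<close>: the difference \<open>Ln \<i> - Ln (- \<i>)\<close> is
    \<open>\<i> * pi\<close>.\<close>
  have "?a \<longlonglongrightarrow> Ln (0 + \<i>)"
    by (rule tendsto_Ln[OF tendsto_add[OF of_nat_scaled_tendsto_0 tendsto_const]])
      (simp add: complex_nonpos_Reals_iff)
  moreover have "?b \<longlonglongrightarrow> Ln (0 - \<i>)"
    by (rule tendsto_Ln[OF tendsto_diff[OF of_nat_scaled_tendsto_0 tendsto_const]])
      (simp add: complex_nonpos_Reals_iff)
  ultimately have "(\<lambda>n. - \<i> * (?a n - ?b n)) \<longlonglongrightarrow> - \<i> * (Ln (0 + \<i>) - Ln (0 - \<i>))"
    by (intro tendsto_mult tendsto_diff tendsto_const)
  also have "- \<i> * (Ln (0 + \<i>) - Ln (0 - \<i>)) = of_real pi"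
    by (simp add: algebra_simps)
  finally show ?thesis
    by (rule Lim_transform_eventually) (auto simp: eq intro: eventually_sequentiallyI[of 1])
qed

text \<open>For an exponent of at least 2 there is an antiderivative that is again a negative power,
  and it vanishes at both ends of the line.\<close>

lemma symint_inverse_power_tendsto:
  assumes "0 < c" "0 < k"
  shows "symint (\<lambda>s. inverse (Complex c s ^ Suc k)) \<longlonglongrightarrow> 0"
proof -
  let ?f = "\<lambda>s. \<i> / of_nat k * inverse (Complex c s ^ k)"
  have nz: "c + \<i> * of_real s \<noteq> 0" for s :: real
    using assms by (auto simp: complex_eq_iff)
  have "symint (\<lambda>s. inverse (Complex c s ^ Suc k)) = (\<lambda>n. ?f n - ?f (- real n))"
  proof (rule ext)
    fix n
    have "(?f has_vector_derivative inverse (Complex c s ^ Suc k)) (at s within {- real n..real n})" for s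
    proof -
      obtain j where j: "k = Suc j" using assms by (cases k) auto
      have "((\<lambda>w. \<i> / of_nat k * inverse (w ^ k)) has_field_derivative
          - \<i> * inverse (w ^ Suc k)) (at w)" if "w \<noteq> 0" for w
        using that unfolding j
        by (intro DERIV_cong[OF DERIV_cmult[OF DERIV_inverse_fun[OF DERIV_power[OF DERIV_ident]]]])
          (auto simp: field_simps simp del: of_nat_Suc)
      moreover have "((\<lambda>z. c + \<i> * z) has_field_derivative \<i>) (at (of_real s))"
        by (auto intro!: derivative_eq_intros)
      ultimately have "((\<lambda>z. \<i> / of_nat k * inverse ((of_real c + \<i> * z) ^ k)) has_field_derivative
          - \<i> * inverse ((c + \<i> * of_real s) ^ Suc k) * \<i>) (at (of_real s))"
        using nz[of s] DERIV_chain2[of "\<lambda>w. \<i> / of_nat k * inverse (w ^ k)" _ "\<lambda>z. of_real c + \<i> * z"]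
        by blast
      also have "- \<i> * inverse ((c + \<i> * of_real s) ^ Suc k) * \<i> = inverse ((c + \<i> * of_real s) ^ Suc k)"
        by (simp add: mult_ac)
      finally have "((\<lambda>z. \<i> / of_nat k * inverse ((c + \<i> * z) ^ k)) has_field_derivative
          inverse ((c + \<i> * of_real s) ^ Suc k)) (at (of_real s))" .
      from has_vector_derivative_at_within[OF has_vector_derivative_real_field[OF this]]
      show ?thesis by (simp only: Complex_eq)
    qed
    from fundamental_theorem_of_calculus[OF _ this]
    show "symint (\<lambda>s. inverse (Complex c s ^ Suc k)) n = ?f n - ?f (- real n)"
      unfolding symint_def by (intro integral_unique) auto
  qed
  moreover have "(\<lambda>n. ?f n - ?f (- real n)) \<longlonglongrightarrow> 0 - 0"
  proof (intro tendsto_diff)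
    \<comment> \<open>A general \<open>g\<close> treats the upper and the lower end
      together.\<close>
    have "(\<lambda>n. ?f (g n)) \<longlonglongrightarrow> 0" if g: "\<And>n. \<bar>g n\<bar> = real n" for g :: "nat \<Rightarrow> real"
    proof -
      have "filterlim (\<lambda>n. norm (Complex c (g n))) at_top sequentially"
      proof (rule filterlim_at_top_mono[OF filterlim_real_sequentially])
        show "\<forall>\<^sub>F n in sequentially. real n \<le> cmod (Complex c (g n))"
          using abs_Im_le_cmod[of "Complex c (g n)" for n] g by auto
      qed
      then have "filterlim (\<lambda>n. Complex c (g n)) at_infinity sequentially"
        by (rule filterlim_norm_at_top_imp_at_infinity)
      then have "filterlim (\<lambda>n. Complex c (g n) ^ k) at_infinity sequentially"
        using assms(2) by (intro filterlim_compose[OF filterlim_power_at_infinity]) auto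
      from tendsto_mult_right_zero[OF filterlim_compose[OF tendsto_inverse_0 this]]
      show ?thesis .
    qed
    from this[of real] this[of "\<lambda>n. - real n"]
    show "(\<lambda>n. ?f n) \<longlonglongrightarrow> 0" "(\<lambda>n. ?f (- real n)) \<longlonglongrightarrow> 0" by auto
  qed
  ultimately show ?thesis
    by (simp only: diff_self)
qed

lemma symint_add:
  assumes "continuous_on UNIV f" "continuous_on UNIV g"
  shows "symint (\<lambda>s. f s + g s) n = symint f n + symint g n"
  unfolding symint_def
  by (intro integral_add integrable_continuous_interval continuous_on_subset[OF assms(1)]
      continuous_on_subset[OF assms(2)]) auto

lemma symint_linear:
  assumes "bounded_linear L" "continuous_on UNIV f"
  shows "symint (\<lambda>s. L (f s)) n = L (symint f n)"
proof -
  have "f integrable_on {- real n..real n}"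
    by (intro integrable_continuous_interval continuous_on_subset[OF assms(2)]) auto
  from integral_linear[OF this assms(1)] show ?thesis
    by (simp add: symint_def o_def)
qed

text \<open>Partial fractions lower the exponent by one at the price of a factor
  \<open>1 / l\<close> and a summand whose integral vanishes. In the base case two principal values
  contribute \<open>pi\<close> each.\<close>

lemma symint_partial_fraction_tendsto:
  assumes "0 < c" "c < Re l"
  shows "symint (\<lambda>s. inverse (Complex c s ^ Suc k * (l - Complex c s))) \<longlonglongrightarrow> of_real (2 * pi) / l ^ Suc k"
proof (induction k)
  case 0
  have nz: "Complex c s \<noteq> 0" "l - Complex c s \<noteq> 0" for s
    using assms by (auto simp: complex_eq_iff)
  have l: "l \<noteq> 0" using assms by auto
  have c1: "continuous_on UNIV (\<lambda>s. inverse (Complex c s))"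
    and c2: "continuous_on UNIV (\<lambda>s. inverse (l - Complex c s))"
    using nz by (auto intro!: continuous_intros)
  have "symint (\<lambda>s. inverse (Complex c s ^ Suc 0 * (l - Complex c s))) = (\<lambda>n.
      1 / l * (symint (\<lambda>s. inverse (Complex c s)) n + symint (\<lambda>s. inverse (l - Complex c s)) n))"
  proof (rule ext)
    fix n
    have "inverse (Complex c s ^ Suc 0 * (l - Complex c s))
        = 1 / l * (inverse (Complex c s) + inverse (l - Complex c s))" for s
      using nz[of s] l by (simp add: field_simps)
    then have "symint (\<lambda>s. inverse (Complex c s ^ Suc 0 * (l - Complex c s))) n
        = symint (\<lambda>s. 1 / l * (inverse (Complex c s) + inverse (l - Complex c s))) n"
      by simp
    also have "\<dots> = 1 / l * symint (\<lambda>s. inverse (Complex c s) + inverse (l - Complex c s)) n"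
      by (rule symint_linear[OF bounded_linear_mult_right]) (intro continuous_intros c1 c2)
    finally show "symint (\<lambda>s. inverse (Complex c s ^ Suc 0 * (l - Complex c s))) n =
        1 / l * (symint (\<lambda>s. inverse (Complex c s)) n + symint (\<lambda>s. inverse (l - Complex c s)) n)"
      by (simp only: symint_add[OF c1 c2])
  qed
  moreover have "symint (\<lambda>s. inverse (Complex c s)) \<longlonglongrightarrow> of_real pi"
    using symint_inverse_tendsto[of "of_real c"] assms by (simp add: Complex_eq)
  moreover have "symint (\<lambda>s. inverse (l - Complex c s)) \<longlonglongrightarrow> of_real pi"
  proof -
    \<comment> \<open>Reflecting \<open>s\<close> turns \<open>l - Complex c s\<close> into
      \<open>w + \<i> * of_real s\<close> with \<open>w = l - c\<close>, whose real part is
      positive.\<close>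
    have "symint (\<lambda>s. inverse (l - Complex c s))
        = symint (\<lambda>s. inverse ((l - of_real c) + \<i> * of_real s))"
    proof (rule ext)
      fix n
      show "symint (\<lambda>s. inverse (l - Complex c s)) n
          = symint (\<lambda>s. inverse ((l - of_real c) + \<i> * of_real s)) n"
        unfolding symint_def Complex_eq
      using Henstock_Kurzweil_Integration.integral_reflect_real[where a = "- real n" and b = "real n" and f = "\<lambda>s. inverse ((l - of_real c) + \<i> * of_real s)"]
        by (simp add: algebra_simps)
    qed
    then show ?thesis
      using symint_inverse_tendsto[of "l - of_real c"] assms by simp
  qed
  ultimately have "symint (\<lambda>s. inverse (Complex c s ^ Suc 0 * (l - Complex c s)))
      \<longlonglongrightarrow> 1 / l * (of_real pi + of_real pi)"
    by (simp only:) (rule tendsto_mult tendsto_add tendsto_const | assumption)+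
  then show ?case by simp
next
  case (Suc k)
  have nz: "Complex c s \<noteq> 0" "l - Complex c s \<noteq> 0" for s
    using assms by (auto simp: complex_eq_iff)
  have l: "l \<noteq> 0" using assms by auto
  let ?f = "\<lambda>k s. inverse (Complex c s ^ Suc k * (l - Complex c s))"
  let ?g = "\<lambda>s. inverse (Complex c s ^ Suc (Suc k))"
  have c1: "continuous_on UNIV (?f k)" and c2: "continuous_on UNIV ?g"
    using nz by (auto intro!: continuous_intros simp del: power_Suc)
  have "symint (?f (Suc k)) = (\<lambda>n. 1 / l * (symint (?f k) n + symint ?g n))"
  proof (rule ext)
    fix n
    have "?f (Suc k) s = 1 / l * (?f k s + ?g s)" for s
      using nz[of s] l by (simp add: field_simps)
    then have "symint (?f (Suc k)) n = symint (\<lambda>s. 1 / l * (?f k s + ?g s)) n"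
      by simp
    also have "\<dots> = 1 / l * symint (\<lambda>s. ?f k s + ?g s) n"
      by (rule symint_linear[OF bounded_linear_mult_right]) (intro continuous_on_add c1 c2)
    finally show "symint (?f (Suc k)) n = 1 / l * (symint (?f k) n + symint ?g n)"
      by (simp only: symint_add[OF c1 c2])
  qed
  then have "symint (?f (Suc k)) \<longlonglongrightarrow> 1 / l * (of_real (2 * pi) / l ^ Suc k + 0)"
    by (simp only:) (rule tendsto_mult tendsto_add tendsto_const Suc.IH
        symint_inverse_power_tendsto[OF assms(1)] zero_less_Suc)+
  then show ?case by simp
qed

section \<open>Inverse Laplace transforms of pseudo-resolvents\<close>

lemma
  assumes "bounded_clinear_op T"
  shows bounded_clinear_op_bounded_linear: "bounded_linear T"
    and bounded_clinear_op_scaleC: "T (scaleC a x) = scaleC a (T x)"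
  using assms by (auto simp: bounded_clinear_op_def)

text \<open>The properties of the right resolvent on which the inversion rests, with
  \<open>q\<close> in the role of the resolvent index. Since \<open>\<omega>\<close> is nonnegative,
  0 lies outside the half-plane and negative powers of \<open>l\<close> are harmless there.\<close>

locale pseudo_resolvent =
  fixes R :: "complex \<Rightarrow> 'x::complex_banach \<Rightarrow> 'x" and \<omega> M :: real and q :: nat
  assumes omega_nonneg: "0 \<le> \<omega>" and M_nonneg: "0 \<le> M"
    and bounded_clinear: "\<omega> < Re l \<Longrightarrow> bounded_clinear_op (R l)"
    and resolvent_identity: "\<omega> < Re l \<Longrightarrow> \<omega> < Re m \<Longrightarrow> R m x = R l x + scaleC (l - m) (R l (R m x))"
    and growth: "\<omega> < Re l \<Longrightarrow> norm (R l x) \<le> M * cmod l powi (int q - 1) * norm x"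
begin

definition F :: "complex \<Rightarrow> 'x \<Rightarrow> 'x" where
  "F l x = scaleC (inverse (l ^ Suc q)) (R l x)"

text \<open>The line of integration, strictly inside the half-plane; \<open>c\<close> becomes the
  exponential growth rate of \<open>S\<close>.\<close>

abbreviation c :: real where "c \<equiv> \<omega> + 1"

section \<open>Decay and holomorphy of the resolvent\<close>

lemma c_pos: "0 < c"
  using omega_nonneg by simp

lemma bounded_linear_R: "\<omega> < Re l \<Longrightarrow> bounded_linear (R l)"
  by (rule bounded_clinear_op_bounded_linear[OF bounded_clinear])

text \<open>In this form the moving point \<open>w\<close> acts on the fixed vector
  \<open>R z x\<close>, which suits limits as \<open>w\<close> tends to \<open>z\<close>.\<close>

lemma resolvent_diff:
  assumes "\<omega> < Re w" "\<omega> < Re z"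
  shows "R w x - R z x = scaleC (z - w) (R w (R z x))"
proof -
  have "R w x - R z x = - scaleC (w - z) (R w (R z x))"
    by (metis resolvent_identity[OF assms] add_diff_cancel_left' minus_diff_eq)
  then show ?thesis
    by (simp flip: scaleC.minus_left)
qed

text \<open>The exponents add up to \<open>(q - 1) - (q + 1) = -2\<close> for every
  \<open>q\<close>.\<close>

lemma norm_F_le:
  assumes "\<omega> < Re l"
  shows "norm (F l x) \<le> M * norm x / (cmod l)\<^sup>2"
proof -
  have l: "cmod l \<noteq> 0" using assms omega_nonneg by auto
  have "norm (F l x) \<le> inverse (cmod l ^ Suc q) * (M * cmod l powi (int q - 1) * norm x)"
    unfolding F_def norm_scaleC norm_inverse norm_power
    by (intro mult_left_mono growth assms) simp
  also have "\<dots> = M * norm x / (cmod l)\<^sup>2"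
    using l by (simp add: power_int_diff field_simps power2_eq_square)
  finally show ?thesis .
qed

text \<open>The growth bound keeps \<open>R w (R z x)\<close> bounded near \<open>z\<close>, while
  the factor \<open>z - w\<close> tends to 0.\<close>

lemma isCont_R:
  assumes "\<omega> < Re z"
  shows "isCont (\<lambda>w. R w x) z"
proof -
  have "((\<lambda>w. R w x - R z x) \<longlongrightarrow> 0) (at z)"
  proof (rule Lim_null_comparison)
    have "\<forall>\<^sub>F w in at z. \<omega> < Re w"
      using assms by (intro order_tendstoD(1)[OF tendsto_Re[OF tendsto_ident_at]])
    then show "\<forall>\<^sub>F w in at z. norm (R w x - R z x)
        \<le> cmod (z - w) * (M * cmod w powi (int q - 1) * norm (R z x))"
    proof eventually_elim
      case (elim w)
      have "R w x - R z x = scaleC (z - w) (R w (R z x))"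
        by (rule resolvent_diff[OF elim assms])
      with elim show ?case
        by (simp add: norm_scaleC mult_left_mono growth)
    qed
    have "z \<noteq> 0" using assms omega_nonneg by auto
    then have "((\<lambda>w. cmod (z - w) * (M * cmod w powi (int q - 1) * norm (R z x))) \<longlongrightarrow>
        cmod (z - z) * (M * cmod z powi (int q - 1) * norm (R z x))) (at z)"
      by (intro tendsto_intros) auto
    then show "((\<lambda>w. cmod (z - w) * (M * cmod w powi (int q - 1) * norm (R z x))) \<longlongrightarrow> 0) (at z)"
      by simp
  qed
  then show ?thesis
    by (simp add: isCont_def LIM_zero_iff)
qed

text \<open>By the resolvent identity the error of the difference quotient is, up to sign,
  \<open>R w (R z x) - R z (R z x)\<close>, so continuity at the vector \<open>R z x\<close>
  suffices.\<close>

lemma has_derivative_R: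
  assumes "\<omega> < Re z"
  shows "((\<lambda>w. R w x) has_derivative (\<lambda>h. scaleC h (- R z (R z x)))) (at z)"
proof (rule has_derivativeI_sandwich)
  show "0 < Re z - \<omega>" using assms by simp
  show "bounded_linear (\<lambda>h. scaleC h (- R z (R z x)))"
    by (rule scaleC.bounded_linear_left)
  show "norm (R w x - R z x - scaleC (w - z) (- R z (R z x))) / norm (w - z)
      \<le> norm (R w (R z x) - R z (R z x))"
    if "w \<noteq> z" "dist w z < Re z - \<omega>" for w
  proof -
    have "\<omega> < Re w"
      using that(2) abs_Re_le_cmod[of "w - z"] by (simp add: dist_norm)
    from resolvent_diff[OF this assms, of x]
    have "R w x - R z x - scaleC (w - z) (- R z (R z x))
        = scaleC (z - w) (R w (R z x) - R z (R z x))"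
      by (simp add: scaleC.diff_left scaleC.diff_right scaleC.minus_right)
    then show ?thesis
      using that(1) by (simp add: norm_scaleC norm_minus_commute)
  qed
  show "((\<lambda>w. norm (R w (R z x) - R z (R z x))) \<longlongrightarrow> 0) (at z)"
    using isCont_R[OF assms, of "R z x"]
    by (simp add: isCont_def LIM_zero_iff tendsto_norm_zero_iff)
qed

lemma continuous_on_R: "continuous_on {z. \<omega> < Re z} (\<lambda>w. R w x)"
  by (auto intro!: continuous_at_imp_continuous_on isCont_R)

text \<open>Operator and argument both move: the growth bound controls the moving argument,
  pointwise continuity the moving operator. The exchange of integrals in the rectangle needs this
  continuity of the derivative.\<close>

lemma continuous_on_R_R: "continuous_on {z. \<omega> < Re z} (\<lambda>w. R w (R w x))"
proof (rule continuous_at_imp_continuous_on, rule ballI)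
  fix z assume "z \<in> {z. \<omega> < Re z}"
  then have z: "\<omega> < Re z" by simp
  have "((\<lambda>w. R w (R w x) - R w (R z x)) \<longlongrightarrow> 0) (at z)"
  proof (rule Lim_null_comparison)
    have "\<forall>\<^sub>F w in at z. \<omega> < Re w"
      using z by (intro order_tendstoD(1)[OF tendsto_Re[OF tendsto_ident_at]])
    then show "\<forall>\<^sub>F w in at z. norm (R w (R w x) - R w (R z x))
        \<le> M * cmod w powi (int q - 1) * norm (R w x - R z x)"
      by eventually_elim
        (simp add: growth flip: linear_diff[OF bounded_linear.linear[OF bounded_linear_R]])
    have "z \<noteq> 0" using z omega_nonneg by auto
    then have "((\<lambda>w. M * cmod w powi (int q - 1) * norm (R w x - R z x)) \<longlongrightarrow>
        M * cmod z powi (int q - 1) * norm (R z x - R z x)) (at z)"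
      using isCont_R[OF z, of x] unfolding isCont_def by (intro tendsto_intros) auto
    then show "((\<lambda>w. M * cmod w powi (int q - 1) * norm (R w x - R z x)) \<longlongrightarrow> 0) (at z)"
      by simp
  qed
  from tendsto_add[OF this isCont_R[OF z, of "R z x", unfolded isCont_def]]
  show "isCont (\<lambda>w. R w (R w x)) z"
    by (simp add: isCont_def)
qed

lemma has_derivative_F:
  assumes "\<omega> < Re z"
  shows "((\<lambda>w. F w x) has_derivative (\<lambda>h. scaleC h
    (scaleC (- of_nat (Suc q) / z ^ (q + 2)) (R z x) - scaleC (inverse (z ^ Suc q)) (R z (R z x))))) (at z)"
proof -
  have z: "z \<noteq> 0" using assms omega_nonneg by auto
  then have "((\<lambda>w. inverse (w ^ Suc q)) has_field_derivative (- of_nat (Suc q) / z ^ (q + 2))) (at z)"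
    by (intro DERIV_cong[OF DERIV_inverse_fun[OF DERIV_power[OF DERIV_ident]]])
      (auto simp: field_simps simp del: of_nat_Suc)
  from scaleC.FDERIV[OF this[unfolded has_field_derivative_def] has_derivative_R[OF assms, of x]]
  show ?thesis
    unfolding F_def
    by (rule has_derivative_eq_rhs)
      (simp add: fun_eq_iff scaleC.diff_right scaleC.minus_right scaleC_scaleC mult.commute)
qed

lemma continuous_on_F: "continuous_on {z. \<omega> < Re z} (\<lambda>w. F w x)"
  by (rule has_derivative_continuous_on, rule has_derivative_at_withinI, rule has_derivative_F) auto

lemma continuous_on_F_line:
  assumes "\<omega> < a" "continuous_on S g"
  shows "continuous_on S (\<lambda>s. F (Complex a (g s)) x)"
  using assms unfolding Complex_eq
  by (intro continuous_on_compose2[OF continuous_on_F]) (auto intro!: continuous_intros)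

section \<open>Contour integrals of \<open>F\<close>\<close>

lemma norm_F_line_le:
  assumes "\<omega> < a"
  shows "norm (F (Complex a s) x) \<le> M * norm x / (a\<^sup>2 + s\<^sup>2)"
  using norm_F_le[of "Complex a s" x] assms by (simp add: cmod_power2)

text \<open>\<open>F\<close> is holomorphic to the right of the line and decays quadratically, so
  the contour can be pushed away. In the constant, \<open>pi\<close> comes from the far vertical
  side and 2 from the two horizontal ones.\<close>

lemma symint_F_tendsto_0: "symint (\<lambda>s. F (Complex c s) x) \<longlonglongrightarrow> 0"
proof (rule Lim_null_comparison)
  let ?K = "M * norm x"
  have K: "0 \<le> ?K" using M_nonneg by simp
  show "(\<lambda>n. ?K * (pi + 2) / real n) \<longlonglongrightarrow> 0"
    by (rule lim_const_over_n)
  have "norm (symint (\<lambda>s. F (Complex c s) x) n) \<le> ?K * (pi + 2) / real n" if n: "0 < n" for n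
  proof -
    \<comment> \<open>The line is moved by \<open>n\<close>, so that all three remaining sides of the rectangle are of order \<open>1 / n\<close>.\<close>
    let ?b = "c + real n"
    let ?f' = "\<lambda>z. scaleC (- of_nat (Suc q) / z ^ (q + 2)) (R z x)
      - scaleC (inverse (z ^ Suc q)) (R z (R z x))"
    have cont: "continuous_on {z. Re z \<in> {c..?b} \<and> Im z \<in> {- real n..real n}} ?f'"
    proof (rule continuous_on_subset)
      show "continuous_on {z. \<omega> < Re z} ?f'"
        using omega_nonneg
        by (intro continuous_on_diff scaleC.continuous_on continuous_on_R continuous_on_R_R)
          (auto intro!: continuous_intros)
    qed auto
    have hor: "norm (integral {c..?b} (\<lambda>u. F (Complex u s) x)) \<le> ?K / real n"
      if s: "\<bar>s\<bar> = real n" for s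
    proof -
      have "norm (integral {c..?b} (\<lambda>u. F (Complex u s) x)) \<le> integral {c..?b} (\<lambda>u. ?K / (real n)\<^sup>2)"
      proof (rule integral_norm_bound_integral)
        show "(\<lambda>u. F (Complex u s) x) integrable_on {c..?b}"
          unfolding Complex_eq
          by (intro integrable_continuous_interval continuous_on_compose2[OF continuous_on_F])
            (auto intro!: continuous_intros)
        fix u assume u: "u \<in> {c..?b}"
        then have "norm (F (Complex u s) x) \<le> ?K / (u\<^sup>2 + s\<^sup>2)"
          by (intro norm_F_line_le) auto
        also have "\<dots> \<le> ?K / (real n)\<^sup>2"
        proof (rule divide_left_mono[OF _ K])
          show "(real n)\<^sup>2 \<le> u\<^sup>2 + s\<^sup>2"
            unfolding s[symmetric] by simp
          then show "0 < (u\<^sup>2 + s\<^sup>2) * (real n)\<^sup>2"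
            using n by (smt (verit) of_nat_0_less_iff zero_less_mult_iff zero_less_power)
        qed
        finally show "norm (F (Complex u s) x) \<le> ?K / (real n)\<^sup>2" .
      qed auto
      also have "\<dots> = ?K / real n"
        using n by (simp add: power2_eq_square)
      finally show ?thesis .
    qed
    have eq: "scaleC \<i> (symint (\<lambda>s. F (Complex ?b s) x) n - symint (\<lambda>s. F (Complex c s) x) n)
        = integral {c..?b} (\<lambda>u. F (Complex u (real n)) x)
          - integral {c..?b} (\<lambda>u. F (Complex u (- real n)) x)"
      unfolding symint_def
      by (intro integral_rectangle[OF _ _ _ cont] has_derivative_F) auto
    have "norm (symint (\<lambda>s. F (Complex ?b s) x) n - symint (\<lambda>s. F (Complex c s) x) n)
        = norm (scaleC \<i> (symint (\<lambda>s. F (Complex ?b s) x) n - symint (\<lambda>s. F (Complex c s) x) n))"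
      by (simp add: norm_scaleC)
    also have "\<dots> \<le> ?K / real n + ?K / real n"
      unfolding eq by (intro order_trans[OF norm_triangle_ineq4] add_mono hor) auto
    finally have "norm (symint (\<lambda>s. F (Complex ?b s) x) n - symint (\<lambda>s. F (Complex c s) x) n)
        \<le> ?K / real n + ?K / real n" .
    moreover have "norm (symint (\<lambda>s. F (Complex ?b s) x) n) \<le> ?K * pi / ?b"
      using omega_nonneg by (intro norm_symint_le continuous_on_F_line norm_F_line_le) auto
    moreover have "?K * pi / ?b \<le> ?K * pi / real n"
      using K n c_pos by (intro divide_left_mono) auto
    ultimately have "norm (symint (\<lambda>s. F (Complex c s) x) n) \<le> ?K * pi / real n + (?K / real n + ?K / real n)"
      using norm_triangle_sub[of "symint (\<lambda>s. F (Complex c s) x) n" "symint (\<lambda>s. F (Complex ?b s) x) n"]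
        norm_minus_commute[of "symint (\<lambda>s. F (Complex c s) x) n" "symint (\<lambda>s. F (Complex ?b s) x) n"]
      by linarith
    then show ?thesis
      by (simp add: add_divide_distrib algebra_simps)
  qed
  then show "\<forall>\<^sub>F n in sequentially. norm (symint (\<lambda>s. F (Complex c s) x) n) \<le> ?K * (pi + 2) / real n"
    by (auto intro: eventually_sequentiallyI[of 1])
qed

lemma symint_Cauchy_kernel_tendsto:
  assumes "c < Re l"
  shows "symint (\<lambda>s. scaleC (inverse (l - Complex c s)) (F (Complex c s) x))
    \<longlonglongrightarrow> scaleC (of_real (2 * pi) / l ^ Suc q) (R l x)"
proof -
  let ?k = "\<lambda>s. inverse (Complex c s ^ Suc q * (l - Complex c s))"
  have nz: "Complex c s \<noteq> 0" "l - Complex c s \<noteq> 0" for s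
    using assms c_pos by (auto simp: complex_eq_iff)
  have l: "\<omega> < Re l" using assms by simp
  have "scaleC (inverse (l - Complex c s)) (F (Complex c s) x)
      = scaleC (?k s) (R l x) + R l (F (Complex c s) x)" for s
  proof -
    let ?m = "Complex c s"
    have "scaleC (inverse (l - ?m)) (F ?m x) = scaleC (?k s) (R ?m x)"
      by (simp add: F_def scaleC_scaleC mult.commute)
    \<comment> \<open>The factor \<open>l - ?m\<close> of the resolvent identity cancels the pole at
      \<open>l\<close>, so the second summand is \<open>R l\<close> applied to
      \<open>F\<close>.\<close>
    also have "\<dots> = scaleC (?k s) (R l x) + scaleC (?k s * (l - ?m)) (R l (R ?m x))"
      by (subst resolvent_identity[OF l, of ?m]) (simp_all add: scaleC.add_right scaleC_scaleC)
    also have "?k s * (l - ?m) = inverse (?m ^ Suc q)"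
      using nz[of s] by simp
    finally show ?thesis
      by (simp add: F_def bounded_clinear_op_scaleC[OF bounded_clinear[OF l]])
  qed
  moreover have "continuous_on UNIV (\<lambda>s. scaleC (?k s) (R l x))"
    using nz by (intro scaleC.continuous_on continuous_intros) (auto simp: Complex_eq intro!: continuous_intros)
  moreover have F: "continuous_on UNIV (\<lambda>s. F (Complex c s) x)"
    by (intro continuous_on_F_line) auto
  moreover have "continuous_on UNIV (\<lambda>s. R l (F (Complex c s) x))"
    by (rule bounded_linear.continuous_on[OF bounded_linear_R[OF l] F])
  moreover have "continuous_on UNIV ?k"
    using nz by (intro continuous_intros) (auto simp: Complex_eq intro!: continuous_intros)
  ultimately have "symint (\<lambda>s. scaleC (inverse (l - Complex c s)) (F (Complex c s) x))
      = (\<lambda>n. scaleC (symint ?k n) (R l x) + R l (symint (\<lambda>s. F (Complex c s) x) n))"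
    by (simp only: fun_eq_iff symint_add symint_linear[OF scaleC.bounded_linear_left]
        symint_linear[OF bounded_linear_R[OF l]] simp_thms)
  moreover have "\<dots> \<longlonglongrightarrow> scaleC (of_real (2 * pi) / l ^ Suc q) (R l x) + R l 0"
    by (intro tendsto_add scaleC.tendsto tendsto_const symint_partial_fraction_tendsto
        bounded_linear.tendsto[OF bounded_linear_R[OF l]] symint_F_tendsto_0 c_pos assms)
  ultimately show ?thesis
    by (simp add: linear_simps bounded_linear_R[OF l])
qed

end

section \<open>The inversion integral and its Laplace transform\<close>

context pseudo_resolvent
begin

definition kernel :: "real \<Rightarrow> 'x \<Rightarrow> real \<Rightarrow> 'x" where
  "kernel t x s = scaleC (exp (Complex c s * of_real t)) (F (Complex c s) x)"

text \<open>The Bromwich inversion integral of \<open>F\<close>. The usual factor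
  \<open>1 / (2 * pi * \<i>)\<close> loses its \<open>\<i>\<close> to the parametrization of the
  vertical line.\<close>

definition S :: "real \<Rightarrow> 'x \<Rightarrow> 'x" where
  "S t x = (1 / (2 * pi)) *\<^sub>R lim (symint (kernel t x))"

lemma continuous_on_kernel: "continuous_on UNIV (kernel t x)"
  unfolding kernel_def
  by (intro scaleC.continuous_on continuous_on_F_line) (auto simp: Complex_eq intro!: continuous_intros)

lemma norm_kernel_le: "norm (kernel t x s) \<le> exp (c * t) * (M * norm x) / (c\<^sup>2 + s\<^sup>2)"
  using mult_left_mono[OF norm_F_line_le[of c s x], of "exp (c * t)"]
  by (simp add: kernel_def norm_scaleC)

lemmas symint_kernel_tail = symint_tail_le[OF c_pos continuous_on_kernel norm_kernel_le]

text \<open>All truncations obey one bound with the factor \<open>pi / c\<close>, which passes to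
  the limit; \<open>1 / (2 * pi)\<close> cancels the \<open>pi\<close>.\<close>

lemma norm_S_le: "norm (S t x) \<le> M / (2 * c) * exp (c * t) * norm x"
proof -
  have "norm (lim (symint (kernel t x))) \<le> exp (c * t) * (M * norm x) * pi / c"
    by (rule tendsto_upperbound[OF tendsto_norm[OF symint_kernel_tail(1)]])
      (auto intro!: always_eventually norm_symint_le[OF c_pos continuous_on_kernel norm_kernel_le])
  then have "norm (S t x) \<le> 1 / (2 * pi) * (exp (c * t) * (M * norm x) * pi / c)"
    unfolding S_def norm_scaleR by (intro mult_mono) auto
  then show ?thesis
    using c_pos by (simp add: field_simps)
qed

lemma F_add: "\<omega> < Re l \<Longrightarrow> F l (x + y) = F l x + F l y"
  by (simp add: F_def linear_add[OF bounded_linear.linear[OF bounded_linear_R]] scaleC.add_right)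

lemma F_scaleC: "\<omega> < Re l \<Longrightarrow> F l (scaleC a x) = scaleC a (F l x)"
  by (simp add: F_def bounded_clinear_op_scaleC[OF bounded_clinear] scaleC_scaleC mult.commute)

lemma S_add: "S t (x + y) = S t x + S t y"
proof -
  have "kernel t (x + y) = (\<lambda>s. kernel t x s + kernel t y s)"
    by (simp add: fun_eq_iff kernel_def F_add scaleC.add_right)
  then have "symint (kernel t (x + y)) = (\<lambda>n. symint (kernel t x) n + symint (kernel t y) n)"
    by (intro ext) (simp add: symint_add[OF continuous_on_kernel continuous_on_kernel])
  moreover have "\<dots> \<longlonglongrightarrow> lim (symint (kernel t x)) + lim (symint (kernel t y))"
    by (intro tendsto_add symint_kernel_tail)
  ultimately show ?thesis
    by (simp add: S_def limI scaleR_add_right)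
qed

lemma S_scaleC: "S t (scaleC a x) = scaleC a (S t x)"
proof -
  have "kernel t (scaleC a x) = (\<lambda>s. scaleC a (kernel t x s))"
    by (simp add: fun_eq_iff kernel_def F_scaleC scaleC_scaleC mult.commute)
  then have "symint (kernel t (scaleC a x)) = (\<lambda>n. scaleC a (symint (kernel t x) n))"
    by (intro ext) (simp add: symint_linear[OF scaleC.bounded_linear_right continuous_on_kernel])
  moreover have "\<dots> \<longlonglongrightarrow> scaleC a (lim (symint (kernel t x)))"
    by (intro scaleC.tendsto tendsto_const symint_kernel_tail)
  ultimately show ?thesis
    by (simp add: S_def limI scaleC.scaleR_right)
qed

lemma S_invariant:
  assumes "closed V" "\<And>x y. x \<in> V \<Longrightarrow> y \<in> V \<Longrightarrow> x + y \<in> V"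
    and scale: "\<And>a x. x \<in> V \<Longrightarrow> scaleC a x \<in> V"
    and "\<And>l x. \<omega> < Re l \<Longrightarrow> x \<in> V \<Longrightarrow> R l x \<in> V" and "x \<in> V"
  shows "S t x \<in> V"
proof -
  have scaleR: "r *\<^sub>R x \<in> V" if "x \<in> V" for r x
    using scale[OF that, of "of_real r"] by (simp add: scaleC_of_real)
  \<comment> \<open>Scaling the given \<open>x\<close> by 0 shows that \<open>V\<close> contains
    0.\<close>
  from this[OF assms(5), of 0] have V: "subspace V"
    by (auto intro!: subspaceI scaleR assms)
  have "symint (kernel t x) n \<in> V" for n
    unfolding symint_def
    by (intro integral_in_closed_subspace[OF assms(1) V] integrable_continuous_interval
        continuous_on_subset[OF continuous_on_kernel])
      (auto simp: kernel_def F_def intro!: assms)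
  from closed_sequentially[OF assms(1) this symint_kernel_tail(1)] show ?thesis
    unfolding S_def by (rule scaleR)
qed

text \<open>The tail of the inversion integral grows like \<open>exp (c * t)\<close>, which the
  damping factor outweighs for \<open>c < Re l\<close>. Uniformity allows the limit to be taken
  under the integral over \<open>{0..T}\<close>.\<close>

lemma uniform_limit_symint_kernel:
  assumes "c < Re l"
  shows "uniform_limit {0..T} (\<lambda>n t. scaleC (exp (- l * of_real t)) (symint (kernel t x) n))
    (\<lambda>t. scaleC (exp (- l * of_real t)) (lim (symint (kernel t x)))) sequentially"
proof (rule uniform_limitI)
  fix e :: real assume "0 < e"
  let ?b = "\<lambda>n. 2 * (M * norm x) / c * (pi / 2 - arctan (real n / c))"
  have "?b \<longlonglongrightarrow> 2 * (M * norm x) / c * (pi / 2 - pi / 2)"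
    by (intro tendsto_intros arctan_scaled_tendsto c_pos)
  then have "\<forall>\<^sub>F n in sequentially. ?b n < e"
    using \<open>0 < e\<close> by (intro order_tendstoD(2)) auto
  then show "\<forall>\<^sub>F n in sequentially. \<forall>t\<in>{0..T}.
      dist (scaleC (exp (- l * of_real t)) (symint (kernel t x) n))
        (scaleC (exp (- l * of_real t)) (lim (symint (kernel t x)))) < e"
  proof (eventually_elim, intro ballI)
    fix n t assume n: "?b n < e" and t: "t \<in> {0..T}"
    have "dist (scaleC (exp (- l * of_real t)) (symint (kernel t x) n))
        (scaleC (exp (- l * of_real t)) (lim (symint (kernel t x))))
        = exp (- Re l * t) * norm (lim (symint (kernel t x)) - symint (kernel t x) n)"
      by (simp add: dist_norm norm_minus_commute norm_scaleC flip: scaleC.diff_right)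
    also have "\<dots> \<le> exp (- Re l * t) * (2 * (exp (c * t) * (M * norm x)) / c * (pi / 2 - arctan (real n / c)))"
      by (intro mult_left_mono symint_kernel_tail(2)) simp
    also have "\<dots> = exp ((c - Re l) * t) * ?b n"
      by (simp add: left_diff_distrib exp_diff exp_minus field_simps)
    also have "\<dots> \<le> 1 * ?b n"
    proof (rule mult_right_mono)
      show "exp ((c - Re l) * t) \<le> 1"
        using assms t by (simp add: mult_nonpos_nonneg)
      show "0 \<le> ?b n"
        using c_pos M_nonneg less_imp_le[OF arctan_ubound[of "real n / c"]]
        by (intro mult_nonneg_nonneg) auto
    qed
    finally show "dist (scaleC (exp (- l * of_real t)) (symint (kernel t x) n))
        (scaleC (exp (- l * of_real t)) (lim (symint (kernel t x)))) < e"
      using n by simp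
  qed
qed

lemma continuous_on_symint_kernel: "continuous_on {0..T} (\<lambda>t. symint (kernel t x) n)"
  unfolding symint_def box_real[symmetric] kernel_def
  by (rule integral_continuous_on_param)
    (auto simp: case_prod_unfold Complex_eq intro!: scaleC.continuous_on continuous_intros
      continuous_on_compose2[OF continuous_on_F])

text \<open>With both variables in compact intervals the integrals may be exchanged, and the inner
  one is elementary. The subtracted term comes from the end \<open>T\<close> and dies out as
  \<open>T\<close> grows.\<close>

lemma integral_symint_kernel:
  assumes "c < Re l" "0 \<le> T"
  shows "integral {0..T} (\<lambda>t. scaleC (exp (- l * of_real t)) (symint (kernel t x) n))
    = symint (\<lambda>s. scaleC (inverse (l - Complex c s)) (F (Complex c s) x)) n
      - symint (\<lambda>s. scaleC (exp ((Complex c s - l) * of_real T) / (l - Complex c s)) (F (Complex c s) x)) n"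
proof -
  have nz: "l - Complex c s \<noteq> 0" for s
    using assms by (auto simp: complex_eq_iff)
  let ?g = "\<lambda>t s. scaleC (exp ((Complex c s - l) * of_real t)) (F (Complex c s) x)"
  have Fc: "continuous_on UNIV (\<lambda>s. F (Complex c s) x)"
    by (intro continuous_on_F_line) auto
  have "integral {0..T} (\<lambda>t. scaleC (exp (- l * of_real t)) (symint (kernel t x) n))
      = integral {0..T} (\<lambda>t. integral {- real n..real n} (?g t))"
  proof (intro integral_cong)
    fix t
    have "scaleC (exp (- l * of_real t)) (kernel t x s) = ?g t s" for s
      by (simp add: kernel_def scaleC_scaleC left_diff_distrib flip: exp_add)
    then show "scaleC (exp (- l * of_real t)) (symint (kernel t x) n) = integral {- real n..real n} (?g t)"
      unfolding symint_linear[OF scaleC.bounded_linear_right continuous_on_kernel, symmetric]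
      by (simp add: symint_def)
  qed
  also have "\<dots> = integral {- real n..real n} (\<lambda>s. integral {0..T} (\<lambda>t. ?g t s))"
    unfolding box_real[symmetric]
    by (rule integral_swap_continuous)
      (auto simp: case_prod_unfold Complex_eq intro!: scaleC.continuous_on continuous_intros
        continuous_on_compose2[OF continuous_on_F])
  also have "\<dots> = symint (\<lambda>s. scaleC (inverse (l - Complex c s)) (F (Complex c s) x)
      - scaleC (exp ((Complex c s - l) * of_real T) / (l - Complex c s)) (F (Complex c s) x)) n"
    unfolding symint_def
  proof (intro integral_cong integral_unique)
    fix s
    let ?m = "Complex c s"
    let ?h = "\<lambda>t. scaleC (- exp ((?m - l) * of_real t) / (l - ?m)) (F ?m x)"
    have "(?h has_vector_derivative ?g t s) (at t within {0..T})" for t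
    proof -
      have "((\<lambda>z. - exp (- d * z) / d) has_field_derivative exp (- d * of_real t)) (at (of_real t))"
        if "d \<noteq> 0" for d :: complex
        using that by (auto intro!: derivative_eq_intros)
      from this[OF nz[of s], unfolded minus_diff_eq]
      have "((\<lambda>z. - exp ((?m - l) * z) / (l - ?m)) has_field_derivative exp ((?m - l) * of_real t)) (at (of_real t))" .
      from has_vector_derivative_at_within[OF has_vector_derivative_real_field[OF this]]
      show ?thesis
        by (rule bounded_linear.has_vector_derivative[OF scaleC.bounded_linear_left])
    qed
    from fundamental_theorem_of_calculus[OF assms(2) this]
    show "((\<lambda>t. ?g t s) has_integral (scaleC (inverse (l - ?m)) (F ?m x)
        - scaleC (exp ((?m - l) * of_real T) / (l - ?m)) (F ?m x))) {0..T}"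
      by (simp add: scaleC.minus_left inverse_eq_divide)
  qed
  also have "\<dots> = symint (\<lambda>s. scaleC (inverse (l - Complex c s)) (F (Complex c s) x)) n
      - symint (\<lambda>s. scaleC (exp ((Complex c s - l) * of_real T) / (l - Complex c s)) (F (Complex c s) x)) n"
    unfolding symint_def using nz
    by (intro integral_diff integrable_continuous_interval scaleC.continuous_on
        continuous_on_subset[OF Fc]) (auto simp: Complex_eq intro!: continuous_intros)
  finally show ?thesis .
qed

text \<open>The limits are taken one after the other: first \<open>n\<close> for fixed
  \<open>T\<close>, with an explicit error, then \<open>T\<close>.\<close>

lemma laplace_transform_S:
  assumes "c < Re l"
  shows "((\<lambda>t. scaleC (exp (- l * of_real t)) (S t x)) has_integral F l x) {0..}"
proof -
  \<comment> \<open>Collects the distance \<open>Re l - c\<close> from \<open>l\<close> to the line,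
    which bounds the denominator below, and the factor \<open>pi / c\<close> of the quadratic
    majorant.\<close>
  let ?K = "M * norm x * pi / (c * (Re l - c))"
  let ?G = "scaleC (of_real (2 * pi) / l ^ Suc q) (R l x)"
  let ?f = "\<lambda>t. scaleC (exp (- l * of_real t)) (lim (symint (kernel t x)))"
  have partial: "?f integrable_on {0..T} \<and> norm (integral {0..T} ?f - ?G) \<le> exp ((c - Re l) * T) * ?K"
    if T: "0 \<le> T" for T
  proof -
    let ?B = "\<lambda>s. scaleC (exp ((Complex c s - l) * of_real T) / (l - Complex c s)) (F (Complex c s) x)"
    have cont: "continuous_on {0..T} (\<lambda>t. scaleC (exp (- l * of_real t)) (symint (kernel t x) n))" for n
      by (intro scaleC.continuous_on continuous_on_symint_kernel continuous_intros)
    \<comment> \<open>Uniform convergence yields both integrability of the limit and convergence of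
      the integrals.\<close>
    obtain I J where IJ: "\<And>n. ((\<lambda>t. scaleC (exp (- l * of_real t)) (symint (kernel t x) n)) has_integral I n) {0..T}"
        "(?f has_integral J) {0..T}" "I \<longlonglongrightarrow> J"
      using uniform_limit_integral[OF uniform_limit_symint_kernel[OF assms] cont
          trivial_limit_sequentially] by blast
    have nz: "l - Complex c s \<noteq> 0" for s
      using assms by (auto simp: complex_eq_iff)
    have B: "norm (symint ?B n) \<le> exp ((c - Re l) * T) * ?K" for n
    proof -
      have "norm (symint ?B n) \<le> exp ((c - Re l) * T) / (Re l - c) * (M * norm x) * pi / c"
      proof (rule norm_symint_le[OF c_pos])
        show "continuous_on UNIV ?B"
          using nz by (intro scaleC.continuous_on continuous_on_F_line)
            (auto simp: Complex_eq intro!: continuous_intros)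
        fix s
        have "Re l - c \<le> cmod (l - Complex c s)"
          using complex_Re_le_cmod[of "l - Complex c s"] by simp
        then have "cmod (exp ((Complex c s - l) * of_real T) / (l - Complex c s))
            \<le> exp ((c - Re l) * T) / (Re l - c)"
          using assms unfolding norm_divide
          by (intro frac_le) auto
        then have "norm (?B s) \<le> exp ((c - Re l) * T) / (Re l - c) * (M * norm x / (c\<^sup>2 + s\<^sup>2))"
          unfolding norm_scaleC using assms
          by (intro mult_mono norm_F_line_le) auto
        then show "norm (?B s) \<le> exp ((c - Re l) * T) / (Re l - c) * (M * norm x) / (c\<^sup>2 + s\<^sup>2)"
          by simp
      qed
      then show ?thesis by (simp add: field_simps)
    qed
    have "I = (\<lambda>n. symint (\<lambda>s. scaleC (inverse (l - Complex c s)) (F (Complex c s) x)) n - symint ?B n)"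
      by (rule ext) (simp only: integral_symint_kernel[OF assms T, symmetric] integral_unique[OF IJ(1)])
    then have "(\<lambda>n. I n - symint (\<lambda>s. scaleC (inverse (l - Complex c s)) (F (Complex c s) x)) n)
        = (\<lambda>n. - symint ?B n)"
      by simp
    moreover have "(\<lambda>n. I n - symint (\<lambda>s. scaleC (inverse (l - Complex c s)) (F (Complex c s) x)) n)
        \<longlonglongrightarrow> J - ?G"
      by (intro tendsto_diff IJ symint_Cauchy_kernel_tendsto assms)
    ultimately have "(\<lambda>n. - symint ?B n) \<longlonglongrightarrow> J - ?G"
      by simp
    from tendsto_upperbound[OF tendsto_norm[OF this]] B
    have "norm (J - ?G) \<le> exp ((c - Re l) * T) * ?K"
      by (simp add: always_eventually)
    with IJ(2) show ?thesis
      by (auto simp: integral_unique)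
  qed
  have "(?f has_integral ?G) {0..}"
  proof (rule has_integral_half_lineI)
    show "?f integrable_on {0..t}" if "0 \<le> t" for t
      using partial that by simp
    have "((\<lambda>T. integral {0..T} ?f - ?G) \<longlongrightarrow> 0) at_top"
    proof (rule Lim_null_comparison)
      show "\<forall>\<^sub>F T in at_top. norm (integral {0..T} ?f - ?G) \<le> exp ((c - Re l) * T) * ?K"
        using partial by (intro eventually_at_top_linorderI[of 0]) simp
      have "LIM T at_top. (c - Re l) * T :> at_bot"
        using assms by (intro filterlim_tendsto_neg_mult_at_bot[OF tendsto_const]) (auto simp: filterlim_ident)
      from tendsto_mult_left_zero[OF filterlim_compose[OF exp_at_bot this]]
      show "((\<lambda>T. exp ((c - Re l) * T) * ?K) \<longlongrightarrow> 0) at_top" .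
    qed
    then show "((\<lambda>T. integral {0..T} ?f) \<longlongrightarrow> ?G) at_top"
      by (rule LIM_zero_cancel)
  qed
  from has_integral_cmul[OF this, of "1 / (2 * pi)"]
  have "((\<lambda>t. scaleC (exp (- l * of_real t)) (S t x)) has_integral (1 / (2 * pi)) *\<^sub>R ?G) {0..}"
    by (simp only: S_def scaleC.scaleR_right)
  also have "(1 / (2 * pi)) *\<^sub>R ?G
      = scaleC (of_real (1 / (2 * pi)) * (of_real (2 * pi) / l ^ Suc q)) (R l x)"
    by (simp only: scaleC_scaleC[symmetric] scaleC_of_real)
  also have "of_real (1 / (2 * pi)) * (of_real (2 * pi) / l ^ Suc q) = inverse (l ^ Suc q)"
    by (simp add: inverse_eq_divide)
  also have "scaleC (inverse (l ^ Suc q)) (R l x) = F l x"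
    by (simp only: F_def)
  finally show ?thesis .
qed

end

section \<open>The right resolvent of an operator pencil\<close>

text \<open>With \<open>y = ?Q m (E x)\<close>, the pencils at \<open>l\<close> and \<open>m\<close>
  differ on \<open>y\<close> by \<open>scaleC (l - m) (E y)\<close>; applying \<open>?Q l\<close>
  gives the claim, as \<open>y\<close> lies in \<open>D\<close>.\<close>

lemma right_resolvent_identity:
  assumes E: "bounded_clinear_op E"
    and l: "l \<in> pencil_resolvent_set E D A" and m: "m \<in> pencil_resolvent_set E D A"
  shows "right_resolvent E D A m x
    = right_resolvent E D A l x + scaleC (l - m) (right_resolvent E D A l (right_resolvent E D A m x))"
proof -
  let ?P = "pencil E A" and ?Q = "pencil_res E D A"
  have bij: "bij_betw (?P k) D UNIV" and Q: "bounded_clinear_op (?Q k)"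
    if "k \<in> pencil_resolvent_set E D A" for k
    using that by (auto simp: pencil_resolvent_set_def)
  let ?y = "?Q m (E x)"
  have Ex: "E x \<in> ?P m ` D"
    using bij[OF m] by (simp add: bij_betw_def)
  have y: "?y \<in> D" "?P m ?y = E x"
    unfolding pencil_res_def by (rule inv_into_into[OF Ex] f_inv_into_f[OF Ex])+
  have "?y = ?Q l (?P l ?y)"
    using bij[OF l] y(1) unfolding pencil_res_def[of _ _ _ l] by (simp add: bij_betw_def inv_into_f_f)
  also have "?P l ?y = ?P m ?y + scaleC (l - m) (E ?y)"
    by (simp add: pencil_def scaleC.diff_left)
  also have "?P m ?y = E x"
    by (rule y(2))
  also have "?Q l (E x + scaleC (l - m) (E ?y)) = ?Q l (E x) + scaleC (l - m) (?Q l (E ?y))"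
    by (simp only: bounded_clinear_op_scaleC[OF Q[OF l]]
        linear_add[OF bounded_linear.linear[OF bounded_clinear_op_bounded_linear[OF Q[OF l]]]])
  finally show ?thesis
    unfolding right_resolvent_def o_apply .
qed

text \<open>Using the resolvent identity with \<open>l\<close> and \<open>m\<close> in both orders
  and comparing, \<open>l - m\<close> can be divided out. The point \<open>l\<^sub>0\<close> may lie
  outside the half-plane, hence the general resolvent set.\<close>

lemma right_resolvent_commute:
  assumes "bounded_clinear_op E"
    and "l \<in> pencil_resolvent_set E D A" and "m \<in> pencil_resolvent_set E D A"
  shows "right_resolvent E D A l (right_resolvent E D A m x)
    = right_resolvent E D A m (right_resolvent E D A l x)"
proof (cases "l = m")
  case False
  let ?R = "right_resolvent E D A"
  have "u = - v" if "a = b + u" "b = a + v" for a b u v :: 'a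
  proof -
    have "u = a - b" using that(1) by simp
    moreover have "v = b - a" using that(2) by simp
    ultimately show ?thesis by simp
  qed
  then have "scaleC (l - m) (?R l (?R m x)) = - scaleC (m - l) (?R m (?R l x))"
    by this (rule right_resolvent_identity assms)+
  then have "scaleC (inverse (l - m)) (scaleC (l - m) (?R l (?R m x)))
      = scaleC (inverse (l - m)) (scaleC (l - m) (?R m (?R l x)))"
    by (simp flip: scaleC.minus_left)
  with False show ?thesis
    by (simp add: scaleC_scaleC scaleC_one)
qed simp

section \<open>Linearity of powers and stability of closures\<close>

lemma bounded_clinear_op_compose:
  "bounded_clinear_op f \<Longrightarrow> bounded_clinear_op g \<Longrightarrow> bounded_clinear_op (f \<circ> g)"
  by (auto simp: bounded_clinear_op_def o_def bounded_linear_compose)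

lemma bounded_clinear_op_funpow:
  fixes f :: "'a::complex_normed_vector \<Rightarrow> 'a"
  assumes "bounded_clinear_op f"
  shows "bounded_clinear_op (f ^^ n)"
proof (induction n)
  case 0
  show ?case by (simp add: bounded_clinear_op_def id_def bounded_linear_ident)
qed (simp add: bounded_clinear_op_compose[unfolded o_def] assms)

lemma bounded_clinear_op_right_resolvent:
  "bounded_clinear_op E \<Longrightarrow> l \<in> pencil_resolvent_set E D A \<Longrightarrow> bounded_clinear_op (right_resolvent E D A l)"
  unfolding right_resolvent_def by (auto intro: bounded_clinear_op_compose simp: pencil_resolvent_set_def)

lemma closure_closed_under:
  assumes "continuous_on UNIV f" "\<And>x. x \<in> V \<Longrightarrow> f x \<in> V" "x \<in> closure V"
  shows "f x \<in> closure V"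
proof -
  have "f ` closure V \<subseteq> closure V"
    using assms(1,2) closure_subset[of V]
    by (intro image_closure_subset) (auto intro: continuous_on_subset)
  with assms(3) show ?thesis by blast
qed

theorem theorem2p6:
  fixes E :: "'x::complex_banach \<Rightarrow> 'z::complex_banach"
    and A :: "'x \<Rightarrow> 'z"
    and D :: "'x set"
    and l\<^sub>0 :: complex
  assumes "bounded_clinear_op E"
    and "closed_densely_defined D A"
    and "has_complex_resolvent_index E D A"
    and "l\<^sub>0 \<in> pencil_resolvent_set E D A"
  shows "\<exists>(S :: real \<Rightarrow> 'x \<Rightarrow> 'x) (\<omega>::real) (C::real). C > 0 \<and>
    (let p = p_res E D A + 1; Xr = X_ran E D A l\<^sub>0 p in
      (\<forall>t\<ge>0. (\<forall>x\<in>Xr. S t x \<in> Xr) \<and>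
              (\<forall>x\<in>Xr. \<forall>y\<in>Xr. S t (x + y) = S t x + S t y) \<and>
              (\<forall>c. \<forall>x\<in>Xr. S t (scaleC c x) = scaleC c (S t x)) \<and>
              (\<forall>x\<in>Xr. norm (S t x) \<le> C * exp (\<omega> * t) * norm x)) \<and>
      (\<forall>l \<in> pencil_resolvent_set E D A. Re l > \<omega> \<longrightarrow>
         (\<forall>x\<^sub>0\<in>Xr. \<exists>I. ((\<lambda>t. scaleC (exp (- l * complex_of_real t)) (S t x\<^sub>0)) has_integral I) {0..}
                      \<and> right_resolvent E D A l x\<^sub>0 = scaleC (l ^ p) I)))"
proof -
  let ?R = "right_resolvent E D A" and ?q = "p_res E D A"
  let ?T = "?R l\<^sub>0 ^^ (?q + 1)"
  let ?X = "X_ran E D A l\<^sub>0 (?q + 1)"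
  have "resolvent_growth E D A ?q"
    using assms(3) unfolding has_complex_resolvent_index_def p_res_def by (auto intro: LeastI)
  then obtain w C where C: "0 < C" "{l. w < Re l} \<subseteq> pencil_resolvent_set E D A"
      "\<And>l. w < Re l \<Longrightarrow> onorm (pencil_res E D A l) \<le> C * cmod l powi (int ?q - 1)"
    unfolding resolvent_growth_def by blast
  \<comment> \<open>The abscissa \<open>w\<close> may be negative, but the half-plane must avoid
    0.\<close>
  define \<omega> where "\<omega> = max w 0"
  have res: "l \<in> pencil_resolvent_set E D A" if "\<omega> < Re l" for l
    using C(2) that by (auto simp: \<omega>_def)
  \<comment> \<open>The constant reflects the factorization of \<open>?R l\<close> into the
    resolvent of the pencil after \<open>E\<close>.\<close>
  interpret pseudo_resolvent ?R \<omega> "C * onorm E" ?q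
  proof
    show "0 \<le> \<omega>" by (simp add: \<omega>_def)
    show "0 \<le> C * onorm E"
      using C(1) onorm_pos_le[OF bounded_clinear_op_bounded_linear[OF assms(1)]] by simp
    show "bounded_clinear_op (?R l)" if "\<omega> < Re l" for l
      by (rule bounded_clinear_op_right_resolvent[OF assms(1) res[OF that]])
    show "?R m x = ?R l x + scaleC (l - m) (?R l (?R m x))" if "\<omega> < Re l" "\<omega> < Re m" for l m x
      by (rule right_resolvent_identity[OF assms(1) res[OF that(1)] res[OF that(2)]])
    show "norm (?R l x) \<le> C * onorm E * cmod l powi (int ?q - 1) * norm x" if l: "\<omega> < Re l" for l x
    proof -
      have Q: "bounded_linear (pencil_res E D A l)"
        using res[OF l] by (simp add: pencil_resolvent_set_def bounded_clinear_op_def)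
      have "norm (?R l x) \<le> onorm (pencil_res E D A l) * norm (E x)"
        by (simp add: right_resolvent_def onorm[OF Q])
      also have "\<dots> \<le> (C * cmod l powi (int ?q - 1)) * (onorm E * norm x)"
        using l C(1) by (intro mult_mono C(3) onorm bounded_clinear_op_bounded_linear[OF assms(1)])
          (auto simp: \<omega>_def)
      finally show ?thesis by (simp add: mult_ac)
    qed
  qed
  have T: "bounded_clinear_op ?T"
    by (intro bounded_clinear_op_funpow bounded_clinear_op_right_resolvent assms)
  note T_lin = bounded_clinear_op_bounded_linear[OF T]
  have sub: "subspace (range ?T)"
    using T_lin by (intro linear_subspace_image[OF bounded_linear.linear] subspace_UNIV)
  have X_R: "?R l x \<in> ?X" if l: "\<omega> < Re l" and x: "x \<in> ?X" for l x
    unfolding X_ran_def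
  \<comment> \<open>\<open>?R l\<close> commutes with \<open>?T\<close>, so it preserves the range
    of \<open>?T\<close>, and by continuity its closure.\<close>
  proof (rule closure_closed_under[where f = "?R l" and V = "range ?T"])
    show "continuous_on UNIV (?R l)"
      by (rule linear_continuous_on[OF bounded_linear_R[OF l]])
    have commute: "?R l ((?R l\<^sub>0 ^^ n) y) = (?R l\<^sub>0 ^^ n) (?R l y)" for n y
      by (induction n) (simp_all add: right_resolvent_commute[OF assms(1) res[OF l] assms(4)])
    then show "?R l z \<in> range ?T" if "z \<in> range ?T" for z
    proof -
      from that obtain y where "z = ?T y" by (rule imageE)
      then have "?R l z = ?T (?R l y)" by (simp only: commute)
      then show ?thesis by (simp only: rangeI)
    qed
  qed (use x in \<open>simp add: X_ran_def\<close>)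
  have X_scale: "scaleC a x \<in> ?X" if x: "x \<in> ?X" for a x
    unfolding X_ran_def
  proof (rule closure_closed_under[where f = "scaleC a" and V = "range ?T"])
    show "continuous_on UNIV (scaleC a :: 'x \<Rightarrow> 'x)"
      by (rule linear_continuous_on[OF scaleC.bounded_linear_right])
    show "scaleC a z \<in> range ?T" if "z \<in> range ?T" for z
      using that bounded_clinear_op_scaleC[OF T, symmetric] by auto
  qed (use x in \<open>simp add: X_ran_def\<close>)
  have X_add: "x + y \<in> ?X" if "x \<in> ?X" "y \<in> ?X" for x y
  proof -
    from that obtain f g where "\<And>n. f n \<in> range ?T" "f \<longlonglongrightarrow> x" "\<And>n. g n \<in> range ?T" "g \<longlonglongrightarrow> y"
      unfolding X_ran_def closure_sequential by blast
    then show ?thesis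
      unfolding X_ran_def closure_sequential
      by (intro exI[of _ "\<lambda>n. f n + g n"] conjI allI tendsto_add subspace_add[OF sub])
  qed
  have X_S: "S t x \<in> ?X" if "x \<in> ?X" for t x
    by (rule S_invariant[OF _ X_add X_scale X_R that]) (simp_all add: X_ran_def)
  \<comment> \<open>Adding 1 keeps the constant positive even when \<open>E\<close> is zero.\<close>
  let ?C = "C * onorm E / (2 * c) + 1"
  have C_pos: "0 < ?C"
    using M_nonneg c_pos by (simp add: add_nonneg_pos)
  have S_bound: "norm (S t x) \<le> ?C * exp (c * t) * norm x" for t x
    by (rule order_trans[OF norm_S_le]) (intro mult_right_mono, auto)
  have S_laplace: "\<exists>I. ((\<lambda>t. scaleC (exp (- l * complex_of_real t)) (S t x)) has_integral I) {0..}
      \<and> ?R l x = scaleC (l ^ (?q + 1)) I" if "c < Re l" for l x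
  proof (intro exI conjI)
    show "((\<lambda>t. scaleC (exp (- l * complex_of_real t)) (S t x)) has_integral F l x) {0..}"
      by (rule laplace_transform_S[OF that])
    have "l \<noteq> 0" using that c_pos by auto
    then show "?R l x = scaleC (l ^ (?q + 1)) (F l x)"
      by (simp add: F_def scaleC_scaleC scaleC_one del: power_Suc)
  qed
  show ?thesis
    unfolding Let_def
    \<comment> \<open>The growth rate is \<open>c\<close>, since the transform formula requires
      \<open>l\<close> to the right of the line of integration.\<close>
    by (rule exI[of _ S], rule exI[of _ c], rule exI[of _ ?C])
      (use C_pos X_S S_add S_scaleC S_bound S_laplace in blast)
qed

end
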